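(* Let $G$ be a weighted graph on $n$ vertices whose Laplacian $L(G)$ is diagonalisable by a dephased complex Hadamard matrix $H$ of order $n$, and let $\lambda_j$ be the eigenvalue of $L(G)$ for the $j$-th column of $H$, $j=1,\dots,n$. Let $a\ne b$ be vertices of $G$ and $\tau\in\mathbb R$. Then (Laplacian) perfect state transfer occurs from vertex $a$ to vertex $b$ in $G$ at time $\tau$ if and only if, for $j=1,\dots,n$, (1) $H_{a,j}=\pm H_{b,j}$, and (2) $-\tau\lambda_j\equiv\begin{cases}0\pmod{2\pi}&\text{if }H_{a,j}=H_{b,j},\\ \pi\pmod{2\pi}&\text{if }H_{a,j}=-H_{b,j}.\end{cases}$
   Context: Graphs are simple and weighted with non-negative real edge weights; $A(G)$ is the matrix of edge weights and $L(G)=D(G)-A(G)$, with $D(G)$ the diagonal matrix of row sums of $A(G)$. A complex Hadamard matrix of order $n$ is an $n\times n$ complex matrix $H$ whose entries all have modulus one and which satisfies $HH^*=nI$; it is dephased if its first row and first column are all-ones vectors. $L(G)$ is diagonalisable by $H$ if every column of $H$ is an eigenvector of $L(G)$. Rows of $H$ are indexed by the vertices of $G$. $\mathbf e_v$ is the characteristic (standard basis) vector of vertex $v$. (Laplacian) perfect state transfer occurs from $a$ to $b$ at time $\tau$ if $e^{-\mathrm i\tau L(G)}\mathbf e_a=\beta\mathbf e_b$ for some complex number $\beta$ with $|\beta|=1$. *)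

theory Defs
  imports
    "Jordan_Normal_Form.Schur_Decomposition"
    "HOL-Library.Real_Mod"
    Complex_Main
begin

text \<open>
  A weighted graph on \<open>n\<close> vertices has vertex set \<open>{0..<n}\<close> and is given by its weight function;
  weight \<open>0\<close> means that there is no edge. Rows and columns of matrices are likewise indexed by
  \<open>0, \<dots>, n - 1\<close>.
\<close>

definition weighted_graph :: "nat \<Rightarrow> (nat \<Rightarrow> nat \<Rightarrow> real) \<Rightarrow> bool" where
  "weighted_graph n w \<longleftrightarrow>
     (\<forall>u<n. \<forall>v<n. w u v \<ge> 0 \<and> w u v = w v u) \<and> (\<forall>v<n. w v v = 0)"

definition adjacency_mat :: "nat \<Rightarrow> (nat \<Rightarrow> nat \<Rightarrow> real) \<Rightarrow> real mat" where
  "adjacency_mat n w = mat n n (\<lambda>(u, v). w u v)"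

definition degree_mat :: "nat \<Rightarrow> (nat \<Rightarrow> nat \<Rightarrow> real) \<Rightarrow> real mat" where
  "degree_mat n w =
     mat n n (\<lambda>(u, v). if u = v then \<Sum>x<n. adjacency_mat n w $$ (u, x) else 0)"

text \<open>The Laplacian is real, but is viewed as a complex matrix throughout.\<close>

definition laplacian :: "nat \<Rightarrow> (nat \<Rightarrow> nat \<Rightarrow> real) \<Rightarrow> complex mat" where
  "laplacian n w = map_mat complex_of_real (degree_mat n w - adjacency_mat n w)"

definition complex_hadamard :: "nat \<Rightarrow> complex mat \<Rightarrow> bool" where
  "complex_hadamard n H \<longleftrightarrow>
     H \<in> carrier_mat n n \<and> (\<forall>i<n. \<forall>j<n. cmod (H $$ (i, j)) = 1) \<and>
     H * mat_adjoint H = of_nat n \<cdot>\<^sub>m 1\<^sub>m n"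

definition dephased :: "nat \<Rightarrow> complex mat \<Rightarrow> bool" where
  "dephased n H \<longleftrightarrow> (\<forall>j<n. H $$ (0, j) = 1) \<and> (\<forall>i<n. H $$ (i, 0) = 1)"

definition diagonalisable_by :: "nat \<Rightarrow> complex mat \<Rightarrow> complex mat \<Rightarrow> bool" where
  "diagonalisable_by n L H \<longleftrightarrow> (\<forall>j<n. \<exists>k. eigenvector L (col H j) k)"

text \<open>
  The exponential series of a square matrix, summed entrywise; by \<open>mat_exp_summable\<close> below
  these series always converge.
\<close>

definition mat_exp :: "complex mat \<Rightarrow> complex mat" where
  "mat_exp A = mat (dim_row A) (dim_row A) (\<lambda>(i, j). \<Sum>k. (A ^\<^sub>m k) $$ (i, j) / fact k)"

definition perfect_state_transfer ::
  "nat \<Rightarrow> (nat \<Rightarrow> nat \<Rightarrow> real) \<Rightarrow> nat \<Rightarrow> nat \<Rightarrow> real \<Rightarrow> bool" where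
  "perfect_state_transfer n w a b \<tau> \<longleftrightarrow>
     (\<exists>\<beta>. cmod \<beta> = 1 \<and>
        mat_exp ((- (\<i> * complex_of_real \<tau>)) \<cdot>\<^sub>m laplacian n w) *\<^sub>v unit_vec n a
          = \<beta> \<cdot>\<^sub>v unit_vec n b)"

lemma mat_exp_summable:
  fixes A :: "complex mat"
  assumes A: "A \<in> carrier_mat n n" and "i < n" "j < n"
  shows "summable (\<lambda>k. (A ^\<^sub>m k) $$ (i, j) / fact k)"
proof -
  define M where "M = (\<Sum>p<n. \<Sum>q<n. cmod (A $$ (p, q)))"
  have M: "cmod (A $$ (p, q)) \<le> M" if "p < n" "q < n" for p q
  proof -
    have "cmod (A $$ (p, q)) \<le> (\<Sum>q<n. cmod (A $$ (p, q)))"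
      using that by (intro member_le_sum) auto
    also have "\<dots> \<le> M"
      unfolding M_def using that
      by (intro member_le_sum[of _ _ "\<lambda>p. \<Sum>q<n. cmod (A $$ (p, q))"]) (auto intro: sum_nonneg)
    finally show ?thesis .
  qed
  have M0: "M \<ge> 0"
    unfolding M_def by (intro sum_nonneg) auto
  have bound: "cmod ((A ^\<^sub>m k) $$ (i, j)) \<le> (real n * M) ^ k" if "i < n" "j < n" for i j k
    using that
  proof (induction k arbitrary: i j)
    case 0
    then show ?case using A by auto
  next
    case (Suc k)
    have "(A ^\<^sub>m Suc k) $$ (i, j) = (\<Sum>l<n. (A ^\<^sub>m k) $$ (i, l) * A $$ (l, j))"
      using A Suc.prems by (auto simp: scalar_prod_def lessThan_atLeast0)
    also have "cmod \<dots> \<le> (\<Sum>l<n. (real n * M) ^ k * M)"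
      using Suc M M0 by (intro sum_norm_le) (auto simp: norm_mult intro!: mult_mono)
    also have "\<dots> = (real n * M) ^ Suc k"
      by simp
    finally show ?case .
  qed
  show ?thesis
  proof (rule summable_comparison_test)
    show "summable (\<lambda>k. inverse (fact k) * (real n * M) ^ k)"
      by (rule summable_exp)
    show "\<exists>N. \<forall>k\<ge>N. norm ((A ^\<^sub>m k) $$ (i, j) / fact k) \<le> inverse (fact k) * (real n * M) ^ k"
      using bound[OF \<open>i < n\<close> \<open>j < n\<close>] by (auto simp: norm_divide divide_simps)
  qed
qed

text \<open>By the next lemma, naming the eigenvalues of a Laplacian by a real-valued family loses no generality.\<close>

lemma laplacian_eigenvalue_real:
  assumes G: "weighted_graph n w" and ev: "eigenvector (laplacian n w) v k"
  shows "k \<in> \<real>"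
proof -
  define L where "L = laplacian n w"
  have L: "L \<in> carrier_mat n n"
    by (intro carrier_matI) (simp_all add: L_def laplacian_def degree_mat_def adjacency_mat_def)
  have sym: "cnj (L $$ (p, q)) = L $$ (q, p)" if "p < n" "q < n" for p q
    using that G by (auto simp: L_def laplacian_def degree_mat_def adjacency_mat_def weighted_graph_def)
  have v: "v \<in> carrier_vec n" "v \<noteq> 0\<^sub>v n" and Lv: "L *\<^sub>v v = k \<cdot>\<^sub>v v"
    using ev L unfolding eigenvector_def L_def[symmetric] by auto
  define S where "S = (\<Sum>p<n. (cmod (v $ p))\<^sup>2)"
  define T where "T = (\<Sum>p<n. \<Sum>q<n. cnj (v $ p) * (L $$ (p, q) * v $ q))"
  have row: "(\<Sum>q<n. L $$ (p, q) * v $ q) = k * v $ p" if "p < n" for p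
    using arg_cong[OF Lv, of "\<lambda>x. x $ p"] that L v
    by (auto simp: scalar_prod_def lessThan_atLeast0)
  have "T = (\<Sum>p<n. cnj (v $ p) * (k * v $ p))"
    unfolding T_def by (intro sum.cong) (auto simp: row simp flip: sum_distrib_left)
  also have "\<dots> = k * of_real S"
    unfolding S_def of_real_sum sum_distrib_left
    by (intro sum.cong) (auto simp: complex_norm_square mult_ac simp del: of_real_power)
  finally have T: "T = k * of_real S" .
  have "cnj T = (\<Sum>p<n. \<Sum>q<n. cnj (v $ q) * (L $$ (q, p) * v $ p))"
    unfolding T_def by (auto simp: sym mult_ac intro!: sum.cong)
  also have "\<dots> = T"
    unfolding T_def by (rule sum.swap)
  finally have "cnj k * of_real S = k * of_real S"
    using T by simp
  moreover have "S \<noteq> 0"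
  proof
    assume "S = 0"
    then have "\<forall>p<n. v $ p = 0"
      unfolding S_def by (subst (asm) sum_nonneg_eq_0_iff) auto
    with v show False by auto
  qed
  ultimately have "cnj k = k" by simp
  then show ?thesis by (simp add: Reals_cnj_iff)
qed

end

theory Submission
  imports Defs
begin

text \<open>
  Since \<open>U = exp (-\<i>\<tau>L)\<close> is symmetric, pairing \<open>U e\<^sub>a = \<beta> e\<^sub>b\<close> (without conjugation) with an eigenvector
  \<open>v\<close> of \<open>L\<close> for \<open>k\<close> gives \<open>exp (-\<i>\<tau>k) v\<^sub>a = \<beta> v\<^sub>b\<close>. The all-ones vector forces \<open>\<beta> = 1\<close>. As \<open>L\<close> is
  real, a column \<open>h\<close> of \<open>H\<close> and its entrywise conjugate are eigenvectors for the same real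
  eigenvalue; multiplying the two resulting identities yields \<open>exp (-\<i>\<tau>k)\<^sup>2 = 1\<close> because the entries
  are unimodular. Conversely, the identities for all columns of \<open>H\<close> determine \<open>U e\<^sub>a\<close> since \<open>H\<close> is
  invertible.
\<close>

section \<open>Matrix powers: transposes and eigenvectors\<close>

lemma pow_mat_commute:
  fixes A :: "'a :: semiring_1 mat"
  assumes A: "A \<in> carrier_mat n n"
  shows "A * A ^\<^sub>m k = A ^\<^sub>m k * A"
proof (induction k)
  case 0
  then show ?case using A by simp
next
  case (Suc k)
  have "A * A ^\<^sub>m Suc k = (A * A ^\<^sub>m k) * A"
    using A assoc_mult_mat[OF A pow_carrier_mat[OF A] A, of k] by simp
  with Suc show ?case by simp
qed

text \<open>Transposition reverses products, so the last factor of \<open>A ^\<^sub>m Suc k\<close>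
  comes out first; \<open>pow_mat_commute\<close> moves it back to the end.\<close>

lemma transpose_pow_mat:
  fixes A :: "'a :: comm_semiring_1 mat"
  assumes A: "A \<in> carrier_mat n n"
  shows "transpose_mat (A ^\<^sub>m k) = transpose_mat A ^\<^sub>m k"
proof (induction k)
  case 0
  then show ?case using A by simp
next
  case (Suc k)
  have "transpose_mat (A ^\<^sub>m Suc k) = transpose_mat A * transpose_mat (A ^\<^sub>m k)"
    using transpose_mult[OF pow_carrier_mat[OF A] A, of k] by simp
  also have "\<dots> = transpose_mat A ^\<^sub>m Suc k"
    using Suc A pow_mat_commute[of "transpose_mat A" n k] by simp
  finally show ?case .
qed

lemma transpose_smult_mat: "transpose_mat (c \<cdot>\<^sub>m A) = c \<cdot>\<^sub>m transpose_mat A"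
  by (rule eq_matI) auto

lemma smult_mat_mult_vec:
  fixes A :: "'a :: comm_ring mat"
  assumes "A \<in> carrier_mat nr nc" and "v \<in> carrier_vec nc"
  shows "(c \<cdot>\<^sub>m A) *\<^sub>v v = c \<cdot>\<^sub>v (A *\<^sub>v v)"
  using assms by (intro eq_vecI) auto

lemma pow_mat_mult_eigenvector:
  fixes A :: "'a :: field mat"
  assumes A: "A \<in> carrier_mat n n" and v: "v \<in> carrier_vec n" and Av: "A *\<^sub>v v = c \<cdot>\<^sub>v v"
  shows "A ^\<^sub>m k *\<^sub>v v = c ^ k \<cdot>\<^sub>v v"
proof (induction k)
  case 0
  then show ?case using A v by simp
next
  case (Suc k)
  have "A ^\<^sub>m Suc k *\<^sub>v v = A ^\<^sub>m k *\<^sub>v (c \<cdot>\<^sub>v v)"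
    using assoc_mult_mat_vec[OF pow_carrier_mat[OF A] A v] Av by simp
  also have "\<dots> = c \<cdot>\<^sub>v (A ^\<^sub>m k *\<^sub>v v)"
    using mult_mat_vec[OF pow_carrier_mat[OF A] v] by simp
  finally show ?case by (simp add: Suc smult_smult_assoc)
qed

section \<open>The matrix exponential\<close>

lemma mat_exp_carrier [simp]:
  "A \<in> carrier_mat n n \<Longrightarrow> mat_exp A \<in> carrier_mat n n"
  by (simp add: mat_exp_def)

text \<open>The series at \<open>(i, j)\<close> on one side and at \<open>(j, i)\<close> on the
  other agree term by term.\<close>

lemma transpose_mat_exp:
  assumes A: "A \<in> carrier_mat n n"
  shows "transpose_mat (mat_exp A) = mat_exp (transpose_mat A)"
proof (rule eq_matI)
  fix i j assume "i < dim_row (mat_exp (transpose_mat A))" "j < dim_col (mat_exp (transpose_mat A))"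
  then have ij: "i < n" "j < n" using A by (auto simp: mat_exp_def)
  have "(transpose_mat A ^\<^sub>m k) $$ (i, j) = (A ^\<^sub>m k) $$ (j, i)" for k
    using ij A by (simp flip: transpose_pow_mat[OF A])
  then show "transpose_mat (mat_exp A) $$ (i, j) = mat_exp (transpose_mat A) $$ (i, j)"
    using ij A by (simp add: mat_exp_def)
qed (use A in \<open>auto simp: mat_exp_def\<close>)

lemma mat_exp_mult_eigenvector:
  assumes A: "A \<in> carrier_mat n n" and v: "v \<in> carrier_vec n" and Av: "A *\<^sub>v v = c \<cdot>\<^sub>v v"
  shows "mat_exp A *\<^sub>v v = exp c \<cdot>\<^sub>v v"
proof (rule eq_vecI)
  fix i assume "i < dim_vec (exp c \<cdot>\<^sub>v v)"
  then have i: "i < n" using v by simp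
  \<comment> \<open>The right-hand side has the shape of the terms of the scalar exponential series
    in \<open>exp_converges\<close>.\<close>
  have sum_pow: "(\<Sum>q<n. (A ^\<^sub>m k) $$ (i, q) / fact k * v $ q) = (c ^ k /\<^sub>R fact k) * v $ i" for k
  proof -
    have "(\<Sum>q<n. (A ^\<^sub>m k) $$ (i, q) * v $ q) = (A ^\<^sub>m k *\<^sub>v v) $ i"
      using i A v by (simp add: scalar_prod_def lessThan_atLeast0)
    also have "\<dots> = c ^ k * v $ i"
      using i v by (simp add: pow_mat_mult_eigenvector[OF A v Av])
    finally show ?thesis
      by (simp add: scaleR_conv_of_real field_simps flip: sum_divide_distrib)
  qed
  \<comment> \<open>The same series is summed twice: entrywise, exchanging the finite sum over
    \<open>q\<close> with the convergent series over \<open>k\<close>, and then as the scalar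
    exponential series. Uniqueness of the sum gives the claim.\<close>
  have "(\<lambda>k. \<Sum>q<n. (A ^\<^sub>m k) $$ (i, q) / fact k * v $ q) sums
      (\<Sum>q<n. (\<Sum>k. (A ^\<^sub>m k) $$ (i, q) / fact k) * v $ q)"
    using mat_exp_summable[OF A i] by (intro sums_sum sums_mult2 summable_sums) auto
  moreover have "(\<lambda>k. \<Sum>q<n. (A ^\<^sub>m k) $$ (i, q) / fact k * v $ q) sums (exp c * v $ i)"
    unfolding sum_pow by (intro sums_mult2 exp_converges)
  ultimately have "(\<Sum>q<n. (\<Sum>k. (A ^\<^sub>m k) $$ (i, q) / fact k) * v $ q) = exp c * v $ i"
    by (rule sums_unique2)
  then show "(mat_exp A *\<^sub>v v) $ i = (exp c \<cdot>\<^sub>v v) $ i"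
    using i A v by (simp add: mat_exp_def scalar_prod_def lessThan_atLeast0)
qed (use A v in \<open>simp add: mat_exp_def\<close>)

section \<open>The Laplacian: symmetry and special eigenvectors\<close>

lemma laplacian_carrier [simp]: "laplacian n w \<in> carrier_mat n n"
  by (intro carrier_matI) (simp_all add: laplacian_def degree_mat_def adjacency_mat_def)

lemma laplacian_dim [simp]: "dim_row (laplacian n w) = n" "dim_col (laplacian n w) = n"
  using laplacian_carrier[of n w] by (blast dest: carrier_matD)+

lemma laplacian_index:
  assumes "u < n" "v < n"
  shows "laplacian n w $$ (u, v) =
    of_real ((if u = v then \<Sum>x<n. w u x else 0) - w u v)"
  using assms by (simp add: laplacian_def degree_mat_def adjacency_mat_def)

lemma transpose_laplacian:
  assumes "weighted_graph n w"
  shows "transpose_mat (laplacian n w) = laplacian n w"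
proof (rule eq_matI)
  fix i j assume "i < dim_row (laplacian n w)" "j < dim_col (laplacian n w)"
  then have "i < n" "j < n" by auto
  then show "transpose_mat (laplacian n w) $$ (i, j) = laplacian n w $$ (i, j)"
    using assms by (auto simp: laplacian_index weighted_graph_def)
qed auto

text \<open>Each row sums to zero because its diagonal entry collects the row's weights. The factor
  \<open>0\<close> is kept so that the equation has the shape of an eigenvector equation.\<close>

lemma laplacian_mult_ones:
  "laplacian n w *\<^sub>v vec n (\<lambda>_. 1) = 0 \<cdot>\<^sub>v vec n (\<lambda>_. 1)"
proof (rule eq_vecI)
  fix i assume "i < dim_vec (0 \<cdot>\<^sub>v vec n (\<lambda>_. 1 :: complex))"
  then have i: "i < n" by simp
  have "(laplacian n w *\<^sub>v vec n (\<lambda>_. 1)) $ i = (\<Sum>j<n. laplacian n w $$ (i, j))"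
    using i by (auto simp: scalar_prod_def lessThan_atLeast0)
  also have "\<dots> = of_real (\<Sum>j<n. (if i = j then \<Sum>x<n. w i x else 0) - w i j)"
    using i by (simp add: laplacian_index)
  also have "\<dots> = 0"
    using i by (simp add: sum_subtractf)
  finally show "(laplacian n w *\<^sub>v vec n (\<lambda>_. 1)) $ i = (0 \<cdot>\<^sub>v vec n (\<lambda>_. 1)) $ i"
    using i by simp
qed auto

text \<open>The entries of the Laplacian and the eigenvalue are real, so conjugating the equation
  changes only the vector.\<close>

lemma laplacian_mult_conjugate:
  assumes v: "v \<in> carrier_vec n" and Lv: "laplacian n w *\<^sub>v v = of_real l \<cdot>\<^sub>v v"
  shows "laplacian n w *\<^sub>v conjugate v = of_real l \<cdot>\<^sub>v conjugate v"
proof (rule eq_vecI)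
  fix i assume "i < dim_vec (of_real l \<cdot>\<^sub>v conjugate v)"
  then have i: "i < n" using v by simp
  have "(laplacian n w *\<^sub>v conjugate v) $ i = cnj ((laplacian n w *\<^sub>v v) $ i)"
    using i v
    by (auto simp: scalar_prod_def laplacian_index intro!: sum.cong)
  also have "\<dots> = (of_real l \<cdot>\<^sub>v conjugate v) $ i"
    using i v by (simp add: Lv)
  finally show "(laplacian n w *\<^sub>v conjugate v) $ i = (of_real l \<cdot>\<^sub>v conjugate v) $ i" .
qed (use v in auto)

section \<open>The transition matrix and perfect state transfer\<close>

context
  fixes n :: nat and w :: "nat \<Rightarrow> nat \<Rightarrow> real" and \<tau> :: real and U :: "complex mat"
  assumes G: "weighted_graph n w"
  defines "U \<equiv> mat_exp ((- (\<i> * complex_of_real \<tau>)) \<cdot>\<^sub>m laplacian n w)"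
begin

lemma transition_carrier: "U \<in> carrier_mat n n"
  unfolding U_def by simp

text \<open>The product \<open>\<bullet>\<close> is bilinear, so \<open>U\<close> moves to the other
  factor as its transpose, which is \<open>U\<close> itself, and there it acts on the eigenvector by
  a scalar.\<close>

lemma eigenvector_scalar_transition:
  assumes v: "v \<in> carrier_vec n" and Lv: "laplacian n w *\<^sub>v v = of_real l \<cdot>\<^sub>v v" and a: "a < n"
  shows "v \<bullet> (U *\<^sub>v unit_vec n a) = cis (- \<tau> * l) * v $ a"
proof -
  let ?A = "(- (\<i> * complex_of_real \<tau>)) \<cdot>\<^sub>m laplacian n w"
  have A: "?A \<in> carrier_mat n n" by simp
  have "transpose_mat ?A = ?A"
    using transpose_laplacian[OF G] by (simp add: transpose_smult_mat)
  then have sym: "transpose_mat U = U"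
    unfolding U_def by (simp add: transpose_mat_exp[OF A])
  have "?A *\<^sub>v v = (- (\<i> * of_real \<tau>) * of_real l) \<cdot>\<^sub>v v"
    using v Lv by (simp add: smult_mat_mult_vec[OF laplacian_carrier] smult_smult_assoc)
  from mat_exp_mult_eigenvector[OF A v this]
  have Uv: "U *\<^sub>v v = cis (- \<tau> * l) \<cdot>\<^sub>v v"
    by (simp add: U_def cis_conv_exp mult_ac)
  have "v \<bullet> (U *\<^sub>v unit_vec n a) = (U *\<^sub>v v) \<bullet> unit_vec n a"
    using transpose_vec_mult_scalar[OF transition_carrier, of "unit_vec n a" v] v
    by (simp add: sym)
  then show ?thesis using v a by (simp add: Uv)
qed

lemma perfect_state_transfer_eigenvector:
  assumes pst: "perfect_state_transfer n w a b \<tau>" and a: "a < n" and b: "b < n"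
    and v: "v \<in> carrier_vec n" and Lv: "laplacian n w *\<^sub>v v = of_real l \<cdot>\<^sub>v v"
  shows "cis (- \<tau> * l) * v $ a = v $ b"
proof -
  obtain \<beta> where \<beta>: "U *\<^sub>v unit_vec n a = \<beta> \<cdot>\<^sub>v unit_vec n b"
    using pst unfolding perfect_state_transfer_def U_def by blast
  \<comment> \<open>Kept general in \<open>v\<close> and \<open>l\<close>: it serves both for the
    all-ones vector, which fixes \<open>\<beta>\<close>, and for the given eigenvector.\<close>
  have eq: "cis (- \<tau> * l) * v $ a = \<beta> * v $ b"
    if "v \<in> carrier_vec n" "laplacian n w *\<^sub>v v = of_real l \<cdot>\<^sub>v v" for v l
    using eigenvector_scalar_transition[OF that a] that(1) b by (simp add: \<beta>)
  have "\<beta> = 1"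
    using eq[of "vec n (\<lambda>_. 1)" 0] laplacian_mult_ones[of n w] a b by simp
  with eq[OF v Lv] show ?thesis by simp
qed

text \<open>By \<open>eq\<close>, every column of \<open>H\<close> has the same pairing with
  \<open>U *\<^sub>v unit_vec n a\<close> as with \<open>unit_vec n b\<close>. Since
  \<open>H\<close> is invertible, the two vectors coincide.\<close>

lemma perfect_state_transfer_hadamardI:
  assumes H: "complex_hadamard n H" and a: "a < n" and b: "b < n"
    and ev: "\<And>j. j < n \<Longrightarrow> laplacian n w *\<^sub>v col H j = of_real (lam j) \<cdot>\<^sub>v col H j"
    and eq: "\<And>j. j < n \<Longrightarrow> cis (- \<tau> * lam j) * H $$ (a, j) = H $$ (b, j)"
  shows "perfect_state_transfer n w a b \<tau>"
proof -
  have Hc: "H \<in> carrier_mat n n" and HH: "H * mat_adjoint H = of_nat n \<cdot>\<^sub>m 1\<^sub>m n"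
    using H by (auto simp: complex_hadamard_def)
  have Ac: "mat_adjoint H \<in> carrier_mat n n"
    using Hc by (auto simp: mat_adjoint_def)
  define x where "x = U *\<^sub>v unit_vec n a"
  have x: "x \<in> carrier_vec n"
    using transition_carrier by (auto simp: x_def)
  have Hx: "transpose_mat H *\<^sub>v x = transpose_mat H *\<^sub>v unit_vec n b"
  proof (rule eq_vecI)
    fix j assume "j < dim_vec (transpose_mat H *\<^sub>v unit_vec n b)"
    then have j: "j < n" using Hc by simp
    then show "(transpose_mat H *\<^sub>v x) $ j = (transpose_mat H *\<^sub>v unit_vec n b) $ j"
      using Hc a b eigenvector_scalar_transition[OF _ ev[OF j] a] eq[OF j]
      by (simp add: x_def)
  qed (use Hc in auto)
  \<comment> \<open>Transposing
    \<open>H * mat_adjoint H = of_nat n \<cdot>\<^sub>m 1\<^sub>m n\<close> yields a left inverse of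
    \<open>transpose_mat H\<close> up to the factor \<open>n\<close>.\<close>
  have cancel: "transpose_mat (mat_adjoint H) *\<^sub>v (transpose_mat H *\<^sub>v y) = of_nat n \<cdot>\<^sub>v y"
    if y: "y \<in> carrier_vec n" for y
  proof -
    have "transpose_mat (mat_adjoint H) *\<^sub>v (transpose_mat H *\<^sub>v y)
        = (transpose_mat (mat_adjoint H) * transpose_mat H) *\<^sub>v y"
      using assoc_mult_mat_vec[of "transpose_mat (mat_adjoint H)" n n "transpose_mat H" n y] Hc Ac y
      by simp
    also have "transpose_mat (mat_adjoint H) * transpose_mat H = of_nat n \<cdot>\<^sub>m 1\<^sub>m n"
      by (simp add: HH transpose_smult_mat flip: transpose_mult[OF Hc Ac])
    also have "\<dots> *\<^sub>v y = of_nat n \<cdot>\<^sub>v y"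
      using y by (simp add: smult_mat_mult_vec[OF one_carrier_mat])
    finally show ?thesis .
  qed
  have "of_nat n \<cdot>\<^sub>v x = of_nat n \<cdot>\<^sub>v unit_vec n b"
    using cancel[OF x] cancel[of "unit_vec n b"] Hx by simp
  \<comment> \<open>An index \<open>i < n\<close> forces \<open>n\<close> to be nonzero, so the
    factor \<open>of_nat n\<close> cancels.\<close>
  from arg_cong[OF this, of "\<lambda>v. v $ i" for i]
  have "x $ i = unit_vec n b $ i" if "i < n" for i
    using that x by (metis carrier_vecD index_smult_vec(1) index_unit_vec(3) less_nat_zero_code
        mult_left_cancel of_nat_eq_0_iff)
  then have "x = 1 \<cdot>\<^sub>v unit_vec n b"
    using x by (intro eq_vecI) auto
  then show ?thesis
    unfolding perfect_state_transfer_def x_def U_def by (intro exI[of _ 1]) simp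
qed

end

section \<open>Phases, signs and the equivalence\<close>

lemma cis_eq_minus_one_iff: "cis x = -1 \<longleftrightarrow> [x = pi] (rmod (2 * pi))"
  using cis_eq_iff[of x pi] by simp

lemma cis_eq_one_iff_rcong: "cis x = 1 \<longleftrightarrow> [x = 0] (rmod (2 * pi))"
  using cis_eq_iff[of x 0] by simp

theorem corollary4p4:
  fixes n :: nat and w :: "nat \<Rightarrow> nat \<Rightarrow> real" and H :: "complex mat"
    and lam :: "nat \<Rightarrow> real" and a b :: nat and \<tau> :: real
  assumes "weighted_graph n w"
    and "complex_hadamard n H" and "dephased n H"
    and "diagonalisable_by n (laplacian n w) H"
    and "\<And>j. j < n \<Longrightarrow> eigenvector (laplacian n w) (col H j) (complex_of_real (lam j))"
    and "a < n" and "b < n" and "a \<noteq> b"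
  shows "perfect_state_transfer n w a b \<tau> \<longleftrightarrow>
    (\<forall>j<n.
       (H $$ (a, j) = H $$ (b, j) \<or> H $$ (a, j) = - H $$ (b, j)) \<and>
       (H $$ (a, j) = H $$ (b, j) \<longrightarrow> [- \<tau> * lam j = 0] (rmod (2 * pi))) \<and>
       (H $$ (a, j) = - H $$ (b, j) \<longrightarrow> [- \<tau> * lam j = pi] (rmod (2 * pi))))"
    (is "_ \<longleftrightarrow> (\<forall>j<n. ?C j)")
proof
  note ab = \<open>a < n\<close> \<open>b < n\<close>
  have Hc: "H \<in> carrier_mat n n" and unimodular: "\<And>i j. i < n \<Longrightarrow> j < n \<Longrightarrow> cmod (H $$ (i, j)) = 1"
    using assms(2) by (auto simp: complex_hadamard_def)
  have ev: "laplacian n w *\<^sub>v col H j = of_real (lam j) \<cdot>\<^sub>v col H j" if "j < n" for j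
    using assms(5)[OF that] by (simp add: eigenvector_def)
  show "\<forall>j<n. ?C j" if pst: "perfect_state_transfer n w a b \<tau>"
  proof (intro allI impI)
    fix j assume j: "j < n"
    define z where "z = cis (- \<tau> * lam j)"
    have h: "col H j \<in> carrier_vec n"
      using Hc by auto
    note transfer = perfect_state_transfer_eigenvector[OF assms(1) pst ab]
    have eq: "z * H $$ (a, j) = H $$ (b, j)"
      using transfer[OF h ev[OF j]] Hc ab j by (simp add: z_def)
    \<comment> \<open>The conjugated column belongs to the same eigenvalue, so the same phase
      \<open>z\<close> appears.\<close>
    have eq': "z * cnj (H $$ (a, j)) = cnj (H $$ (b, j))"
      using transfer[OF _ laplacian_mult_conjugate[OF h ev[OF j]]] Hc ab j by (simp add: z_def)
    have unit: "H $$ (i, j) * cnj (H $$ (i, j)) = 1" if "i < n" for i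
      using unimodular[OF that j] by (simp flip: complex_norm_square)
    have "z\<^sup>2 = (z * H $$ (a, j)) * (z * cnj (H $$ (a, j)))"
      using unit[OF ab(1)] by (simp add: power2_eq_square mult_ac)
    also have "\<dots> = 1"
      unfolding eq eq' using unit[OF ab(2)] .
    finally have "z = 1 \<or> z = -1"
      by (simp add: power2_eq_1_iff)
    \<comment> \<open>A unimodular entry is nonzero, so the two sign cases exclude each other:
      \<open>z = 1\<close> leaves only equal entries and \<open>z = -1\<close> only opposite
      ones.\<close>
    moreover have "H $$ (a, j) \<noteq> - H $$ (a, j)"
      using unimodular[OF ab(1) j] by (auto simp: eq_neg_iff_add_eq_0 simp flip: mult_2)
    ultimately show "?C j"
      using eq[symmetric] unfolding cis_eq_one_iff_rcong[symmetric] cis_eq_minus_one_iff[symmetric] z_def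
      by auto
  qed
  show "perfect_state_transfer n w a b \<tau>" if "\<forall>j<n. ?C j"
  proof (rule perfect_state_transfer_hadamardI[OF assms(1,2) ab ev])
    fix j assume "j < n"
    with that have "?C j" by blast
    \<comment> \<open>In either sign case the congruence makes the phase equal to that sign.\<close>
    then show "cis (- \<tau> * lam j) * H $$ (a, j) = H $$ (b, j)"
      unfolding cis_eq_one_iff_rcong[symmetric] cis_eq_minus_one_iff[symmetric] by auto
  qed
qed

end
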